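(* Let $\delta\ge1$ be an integer and $n\ge0$. Let $H_n$ be the mean hitting time for the random walk on the weighted graph $\mathcal{W}_n$. Then $$H_n=\frac{4\delta(\delta+1)^{n+1}+24(\delta+4)^n(\delta+1)^{n+1}-12(\delta+2)(\delta+4)^n}{3\delta(\delta+4)(\delta+1)^n}.$$
   Context: The random walk on a weighted graph moves at each time step from its current vertex $i$ to a neighbor $j$ with probability $w_{ij}/s_i$, where $w_{ij}$ is the weight of edge $ij$ and $s_i=\sum_j w_{ij}$ is the strength of $i$. Its stationary distribution is $\pi_i=s_i/\sum_{l}s_l$. $H_{ij}$ denotes the expected time for the walk started at $i$ to first reach $j$ (with $H_{ii}=0$). The mean hitting time is $H=\sum_{j}\pi_jH_{ij}$, which does not depend on the starting vertex $i$. The weighted graphs $\mathcal{W}_n$ ($n\ge 0$) are defined recursively for a fixed integer $\delta\ge1$. $\mathcal{W}_0$ is a triangle whose three edges have weight $1$. For $n\ge1$, $\mathcal{W}_n$ is obtained from $\mathcal{W}_{n-1}$ as follows: (I) for each vertex $i$ of $\mathcal{W}_{n-1}$, of strength $s_i$ in $\mathcal{W}_{n-1}$ (always an even integer), take $s_i/2$ new disjoint copies of $\mathcal{K}_2$ (two vertices joined by an edge of weight $1$) and join both vertices of each copy to $i$ by edges of weight $1$; (II) multiply the weight of every edge that already belonged to $\mathcal{W}_{n-1}$ by $1+\delta$. *)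

theory Defs
  imports "HOL-Probability.Probability"
begin

section \<open>Weighted graphs and their random walk\<close>

text \<open>A weight of 0 means that the two vertices are not joined by an edge. All weights of the graphs
  \<open>W\<^sub>n\<close> are natural numbers.\<close>

record 'a weighted_graph =
  verts :: "'a set"
  weight :: "'a \<Rightarrow> 'a \<Rightarrow> nat"

definition strength :: "'a weighted_graph \<Rightarrow> 'a \<Rightarrow> nat" where
  "strength G i = (\<Sum>j\<in>verts G. weight G i j)"

definition stationary :: "'a weighted_graph \<Rightarrow> 'a \<Rightarrow> real" where
  "stationary G i = real (strength G i) / real (\<Sum>l\<in>verts G. strength G l)"

text \<open>\<open>step_pmf\<close> is unspecified at vertices of strength 0 and outside the graph; a walk
  started in one of the graphs \<open>W\<^sub>n\<close> almost surely never visits these.\<close>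

definition step_pmf :: "'a weighted_graph \<Rightarrow> 'a \<Rightarrow> 'a pmf" where
  "step_pmf G i = embed_pmf (\<lambda>j. real (weight G i j) / real (strength G i))"

text \<open>The kernel that produces the position at time \<open>t\<close> from the positions \<open>\<omega> 0, \<dots>, \<omega> (t - 1)\<close>.\<close>

definition walk_kernel :: "'a weighted_graph \<Rightarrow> 'a \<Rightarrow> nat \<Rightarrow> (nat \<Rightarrow> 'a) \<Rightarrow> 'a measure" where
  "walk_kernel G i t \<omega> = measure_pmf (if t = 0 then return_pmf i else step_pmf G (\<omega> (t - 1)))"

lemma Ionescu_Tulcea_walk_kernel:
  "Ionescu_Tulcea (walk_kernel G i) (\<lambda>_. count_space UNIV)"
proof (rule Ionescu_Tulcea.intro)
  fix t :: nat
  show "walk_kernel G i t \<in> measurable (PiM {0..<t} (\<lambda>_. count_space UNIV))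
          (subprob_algebra (count_space UNIV))"
  proof (cases t)
    case 0
    then show ?thesis
      by (simp add: walk_kernel_def[abs_def] space_subprob_algebra
          measure_pmf.subprob_space_axioms)
  next
    case (Suc s)
    have "(\<lambda>\<omega>. \<omega> s) \<in> measurable (PiM {0..<t} (\<lambda>_. count_space UNIV)) (count_space UNIV)"
      using Suc by (intro measurable_component_singleton) simp
    then have "(\<lambda>\<omega>. measure_pmf (step_pmf G (\<omega> s))) \<in>
        measurable (PiM {0..<t} (\<lambda>_. count_space UNIV)) (subprob_algebra (count_space UNIV))"
      by (rule measurable_compose)
        (simp add: space_subprob_algebra measure_pmf.subprob_space_axioms)
    then show ?thesis
      by (simp add: walk_kernel_def[abs_def] Suc)
  qed
next
  show "prob_space (walk_kernel G i t \<omega>)" for t \<omega>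
    by (simp add: walk_kernel_def measure_pmf.prob_space_axioms)
qed

text \<open>The law, on infinite trajectories, of the random walk started at \<open>i\<close>. It is the projective
  limit that the Ionescu-Tulcea theorem provides for the kernels above.\<close>

definition walk_law :: "'a weighted_graph \<Rightarrow> 'a \<Rightarrow> (nat \<Rightarrow> 'a) measure" where
  "walk_law G i = projective_family.lim UNIV
     (Ionescu_Tulcea.CI (walk_kernel G i) (\<lambda>_. count_space UNIV)) (\<lambda>_. count_space UNIV)"

text \<open>The infimum of the empty set is \<open>\<infinity>\<close>, so a trajectory that misses \<open>j\<close> has hitting time \<open>\<infinity>\<close>.\<close>

definition first_hit :: "'a \<Rightarrow> (nat \<Rightarrow> 'a) \<Rightarrow> ennreal" where
  "first_hit j \<omega> = (INF t\<in>{t. \<omega> t = j}. of_nat t)"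

definition hitting_time :: "'a weighted_graph \<Rightarrow> 'a \<Rightarrow> 'a \<Rightarrow> ennreal" where
  "hitting_time G i j = (\<integral>\<^sup>+\<omega>. first_hit j \<omega> \<partial>walk_law G i)"

definition mean_hitting_time :: "'a weighted_graph \<Rightarrow> 'a \<Rightarrow> ennreal" where
  "mean_hitting_time G i = (\<Sum>j\<in>verts G. ennreal (stationary G j) * hitting_time G i j)"

section \<open>The graphs \<open>W\<^sub>n\<close>\<close>

text \<open>\<open>New n i k b\<close>, for the two values of \<open>b\<close>, are the endpoints of the \<open>k\<close>-th copy of \<open>K\<^sub>2\<close> that
  is attached to \<open>i\<close> when \<open>W\<^sub>n\<close> is built from its predecessor. The index \<open>n\<close> makes the vertices of
  different stages distinct.\<close>

datatype vertex = Base nat | New nat vertex nat bool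

definition new_copies :: "vertex weighted_graph \<Rightarrow> (vertex \<times> nat) set" where
  "new_copies G = {(i, k). i \<in> verts G \<and> k < strength G i div 2}"

definition new_edges :: "nat \<Rightarrow> vertex weighted_graph \<Rightarrow> vertex set set" where
  "new_edges n G =
     {{New n i k False, New n i k True} | i k. (i, k) \<in> new_copies G} \<union>
     {{i, New n i k b} | i k b. (i, k) \<in> new_copies G}"

primrec W :: "nat \<Rightarrow> nat \<Rightarrow> vertex weighted_graph" where
  "W \<delta> 0 =
     \<lparr>verts = {Base 0, Base 1, Base 2},
      weight = (\<lambda>u v. if u \<in> {Base 0, Base 1, Base 2} \<and> v \<in> {Base 0, Base 1, Base 2} \<and> u \<noteq> v
                       then 1 else 0)\<rparr>"
| "W \<delta> (Suc n) =
     \<lparr>verts = verts (W \<delta> n) \<union> {New (Suc n) i k b | i k b. (i, k) \<in> new_copies (W \<delta> n)},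
      weight = (\<lambda>u v. if {u, v} \<in> new_edges (Suc n) (W \<delta> n) then 1
                       else (1 + \<delta>) * weight (W \<delta> n) u v)\<rparr>"

primrec level :: "vertex \<Rightarrow> nat" where
  "level (Base m) = 0"
| "level (New n i k b) = n"

lemma level_le: "v \<in> verts (W \<delta> n) \<Longrightarrow> level v \<le> n"
  by (induction n) (auto intro: le_SucI)

lemma finite_W: "finite (verts (W \<delta> n))"
proof (induction n)
  case (Suc n)
  let ?S = "SIGMA i:verts (W \<delta> n). {..<strength (W \<delta> n) i div 2}"
  have "finite ((\<lambda>((i, k), b). New (Suc n) i k b) ` (?S \<times> UNIV))"
    using Suc by (intro finite_imageI finite_cartesian_product finite_SigmaI) auto
  moreover have "{New (Suc n) i k b | i k b. (i, k) \<in> new_copies (W \<delta> n)} \<subseteq> (\<lambda>((i, k), b). New (Suc n) i k b) ` (?S \<times> UNIV)"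
    by (force simp: new_copies_def)
  ultimately have "finite {New (Suc n) i k b | i k b. (i, k) \<in> new_copies (W \<delta> n)}"
    by (rule finite_subset[rotated])
  then show ?case using Suc by simp
qed simp

lemma weight_outside: "\<not> (u \<in> verts (W \<delta> n) \<and> v \<in> verts (W \<delta> n)) \<Longrightarrow> weight (W \<delta> n) u v = 0"
  by (induction n) (auto simp: new_edges_def new_copies_def doubleton_eq_iff)

lemma weight_commute: "weight (W \<delta> n) u v = weight (W \<delta> n) v u"
  by (induction n) (auto simp: insert_commute)

lemma weight_self: "weight (W \<delta> n) u u = 0"
proof (induction n)
  case (Suc n)
  have "{u,u} \<notin> new_edges (Suc n) (W \<delta> n)"
    using level_le[of u \<delta> n] by (auto simp: new_edges_def new_copies_def doubleton_eq_iff)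
  with Suc show ?case by simp
qed auto

text \<open>By the following lemma \<open>strength G i div 2\<close> in \<open>new_copies\<close> is an exact division.\<close>

lemma even_strength_W: "i \<in> verts (W \<delta> n) \<Longrightarrow> even (strength (W \<delta> n) i)"
proof (induction n arbitrary: i)
  case 0 then show ?case by (auto simp: strength_def)
next
  case (Suc n)
  let ?G = "W \<delta> n" let ?H = "W \<delta> (Suc n)" let ?N = "New (Suc n)"
  let ?new = "{?N i k b | i k b. (i, k) \<in> new_copies ?G}"
  have fresh: "?N j k b \<notin> verts ?G" for j k b using level_le[of "?N j k b" \<delta> n] by auto
  have fin: "finite (verts ?G)" "finite ?new" using finite_W[of \<delta> n] finite_W[of \<delta> "Suc n"] by auto
  have disj: "verts ?G \<inter> ?new = {}" using fresh by auto
  have split: "strength ?H i = (\<Sum>j\<in>verts ?G. weight ?H i j) + (\<Sum>j\<in>?new. weight ?H i j)" for i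
    unfolding strength_def using sum.union_disjoint[OF fin disj] by simp
  show ?case
  proof (cases "i \<in> verts ?G")
    case True
    have ne: "{i, j} \<notin> new_edges (Suc n) ?G" if "j \<in> verts ?G" for j
      using that True fresh by (auto simp: new_edges_def doubleton_eq_iff)
    have "(\<Sum>j\<in>verts ?G. weight ?H i j) = (1 + \<delta>) * strength ?G i"
      using ne by (simp add: strength_def sum_distrib_left)
    moreover have "(\<Sum>j\<in>?new. weight ?H i j) = card ((\<lambda>(k, b). ?N i k b) ` ({..<strength ?G i div 2} \<times> UNIV))"
    proof -
      have "(\<Sum>j\<in>?new. weight ?H i j) = (\<Sum>j\<in>(\<lambda>(k, b). ?N i k b) ` ({..<strength ?G i div 2} \<times> UNIV). 1)"
        using True fresh fin weight_outside[of i \<delta> n]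
        by (intro sum.mono_neutral_cong_right) (auto simp: new_edges_def doubleton_eq_iff new_copies_def image_iff)
      then show ?thesis by simp
    qed
    moreover have "\<dots> = strength ?G i div 2 * 2"
      by (subst card_image) (auto simp: inj_on_def card_cartesian_product)
    ultimately show ?thesis using split[of i] Suc.IH[OF True] by simp
  next
    case False
    then obtain j k b where i: "i = ?N j k b" "(j, k) \<in> new_copies ?G" using Suc.prems by auto
    have j: "j \<in> verts ?G" using i by (auto simp: new_copies_def)
    have "(\<Sum>l\<in>verts ?G. weight ?H i l) = (\<Sum>l\<in>{j}. 1)"
      using fin fresh i j weight_outside[of i \<delta> n]
      by (intro sum.mono_neutral_cong_right) (auto simp: new_edges_def doubleton_eq_iff)
    moreover have "(\<Sum>l\<in>?new. weight ?H i l) = (\<Sum>l\<in>{?N j k (\<not> b)}. 1)"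
      using fin fresh i j weight_outside[of i \<delta> n]
      by (intro sum.mono_neutral_cong_right; cases b) (auto simp: new_edges_def new_copies_def doubleton_eq_iff)
    ultimately show ?thesis using split[of i] by simp
  qed
qed

lemma pmf_step_pmf_W:
  assumes "strength (W \<delta> n) i > 0"
  shows "pmf (step_pmf (W \<delta> n) i) j = weight (W \<delta> n) i j / strength (W \<delta> n) i"
  unfolding step_pmf_def
proof (subst pmf_embed_pmf)
  have "(\<integral>\<^sup>+ x. ennreal (real (weight (W \<delta> n) i x) / real (strength (W \<delta> n) i)) \<partial>count_space UNIV)
    = (\<Sum>x\<in>verts (W \<delta> n). ennreal (real (weight (W \<delta> n) i x) / real (strength (W \<delta> n) i)))"
    using weight_outside[of i \<delta> n] by (intro nn_integral_count_space') (auto simp: finite_W)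
  also have "\<dots> = 1" using assms
    by (simp add: sum_ennreal flip: sum_divide_distrib) (simp add: strength_def sum_ennreal flip: of_nat_sum)
  finally show "(\<integral>\<^sup>+ x. ennreal (real (weight (W \<delta> n) i x) / real (strength (W \<delta> n) i)) \<partial>count_space UNIV) = 1" .
qed auto

end

theory Submission
  imports Defs
begin

text \<open>The matrix of hitting times of \<open>W\<^sub>n\<^sub>+\<^sub>1\<close> can be written down from that of \<open>W\<^sub>n\<close>.
  Seen only at the old vertices, the walk on \<open>W\<^sub>n\<^sub>+\<^sub>1\<close> is the walk on \<open>W\<^sub>n\<close> slowed down by the
  factor \<open>T = (4 + \<delta>) / (1 + \<delta>)\<close>, because each visit to an old vertex is followed by excursions into the
  attached triangles. From a new vertex it takes time 2 on average to return to the attaching vertex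
  \<open>i\<close>, and by the commute time identity with effective resistance \<open>2 / 3\<close> it takes
  \<open>a = 2 S / 3 - 2\<close> to reach a given new vertex from \<open>i\<close>, where \<open>S = 6 (\<delta> + 4)\<^sup>n\<^sup>+\<^sup>1\<close> is the total
  strength of \<open>W\<^sub>n\<^sub>+\<^sub>1\<close>. Averaging over the target yields a linear recurrence for the mean hitting
  time. That the matrix found in this way consists of the true hitting times follows because any finite
  nonnegative solution \<open>h\<close> of the first-step equations equals the expected hitting time: \<open>h\<close>
  minus the expected time truncated at \<open>N\<close> is the expectation of \<open>h\<close> at time \<open>N\<close> on survival, which
  tends to 0.\<close>

section \<open>First-step equations determine the hitting times\<close>

lemma nn_integral_walk_law_restrict:
  assumes g: "g \<in> borel_measurable (PiM {0..<t} (\<lambda>_. count_space UNIV))"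
  shows "(\<integral>\<^sup>+\<omega>. g (restrict \<omega> {0..<t}) \<partial>walk_law G i)
    = (\<integral>\<^sup>+\<omega>. g \<omega> \<partial>Ionescu_Tulcea.C (walk_kernel G i) (\<lambda>_. count_space UNIV) 0 t (\<lambda>_. undefined))"
proof -
  interpret Ionescu_Tulcea "walk_kernel G i" "\<lambda>_. count_space UNIV"
    by (rule Ionescu_Tulcea_walk_kernel)
  \<comment> \<open>\<open>CI\<close> projects the finite composition \<open>C 0 m\<close>, where
    \<open>m\<close> is given by \<open>up_to\<close>; for an initial segment \<open>m\<close> is
    its length and the projection is the identity.\<close>
  have up: "up_to {0..<t} = t"
    unfolding up_to_def by (rule Least_equality) (auto simp: not_le[symmetric])
  have "(\<integral>\<^sup>+\<omega>. g (restrict \<omega> {0..<t}) \<partial>walk_law G i)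
      = (\<integral>\<^sup>+\<omega>. g \<omega> \<partial>distr (walk_law G i) (PiM {0..<t} (\<lambda>_. count_space UNIV)) (\<lambda>\<omega>. restrict \<omega> {0..<t}))"
    using g
    by (intro nn_integral_distr[symmetric])
       (auto simp only: walk_law_def measurable_cong_sets[OF PF.sets_lim refl] measurable_restrict_subset
         measurable_distr_eq1 subset_UNIV)
  also have "\<dots> = (\<integral>\<^sup>+\<omega>. g \<omega> \<partial>CI {0..<t})"
    unfolding walk_law_def by (subst distr_lim) auto
  also have "CI {0..<t} = C 0 t (\<lambda>_. undefined)"
    using distr_C[of t t "\<lambda>_. undefined" 0] by (simp add: CI_def up space_PiM)
  finally show ?thesis .
qed

lemma sets_walk_law [measurable_cong]:
  "sets (walk_law G i) = sets (PiM UNIV (\<lambda>_. count_space UNIV))"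
proof -
  interpret Ionescu_Tulcea "walk_kernel G i" "\<lambda>_. count_space UNIV"
    by (rule Ionescu_Tulcea_walk_kernel)
  show ?thesis by (simp add: walk_law_def)
qed

text \<open>The composition \<open>C\<close> grows by one kernel \<open>eP t\<close> at a time,
  which appends a draw from \<open>walk_kernel\<close> to the trajectory. Transferring both stages
  to \<open>walk_law\<close> gives the conditioning behind the Markov property.\<close>

lemma nn_integral_walk_law_extend:
  assumes g: "g \<in> borel_measurable (PiM {0..<Suc t} (\<lambda>_. count_space UNIV))"
  shows "(\<integral>\<^sup>+\<omega>. g (restrict \<omega> {0..<Suc t}) \<partial>walk_law G i)
    = (\<integral>\<^sup>+\<omega>. (\<integral>\<^sup>+x. g ((restrict \<omega> {0..<t})(t := x))
         \<partial>walk_kernel G i t (restrict \<omega> {0..<t})) \<partial>walk_law G i)"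
proof -
  interpret Ionescu_Tulcea "walk_kernel G i" "\<lambda>_. count_space UNIV"
    by (rule Ionescu_Tulcea_walk_kernel)
  note g [measurable]
  have u: "(\<lambda>_. undefined) \<in> space (PiM {0..<0} (\<lambda>_::nat. count_space UNIV))"
    by (simp add: space_PiM)
  have eP: "eP t \<in> measurable (C 0 t (\<lambda>_. undefined)) (subprob_algebra (PiM {0..<Suc t} (\<lambda>_. count_space UNIV)))"
    using measurable_eP[of t] by (simp add: measurable_cong_sets[OF sets_C[OF u] refl])
  have "(\<integral>\<^sup>+\<omega>. g (restrict \<omega> {0..<Suc t}) \<partial>walk_law G i)
      = (\<integral>\<^sup>+\<omega>. (\<integral>\<^sup>+\<omega>'. g \<omega>' \<partial>eP t \<omega>) \<partial>C 0 t (\<lambda>_. undefined))"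
    by (subst nn_integral_walk_law_restrict[OF g]) (simp add: nn_integral_bind[OF g eP])
  also have "\<dots> = (\<integral>\<^sup>+\<omega>. (\<integral>\<^sup>+\<omega>'. g \<omega>' \<partial>eP t (restrict \<omega> {0..<t})) \<partial>walk_law G i)"
    by (rule nn_integral_walk_law_restrict[symmetric]) measurable
  also have "\<dots> = (\<integral>\<^sup>+\<omega>. (\<integral>\<^sup>+x. g ((restrict \<omega> {0..<t})(t := x))
         \<partial>walk_kernel G i t (restrict \<omega> {0..<t})) \<partial>walk_law G i)"
    by (intro nn_integral_cong nn_integral_eP[OF _ g]) (simp add: space_PiM)
  finally show ?thesis .
qed

text \<open>The expectation of \<open>f\<close> at time \<open>t\<close> on the event that the walk
  has stayed in \<open>D\<close> up to and including time \<open>t\<close>. For \<open>f = 1\<close>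
  and \<open>D\<close> the complement of \<open>{j}\<close> it is the probability that the hitting
  time of \<open>j\<close> exceeds \<open>t\<close>.\<close>

definition killed :: "'a weighted_graph \<Rightarrow> 'a \<Rightarrow> 'a set \<Rightarrow> nat \<Rightarrow> ('a \<Rightarrow> ennreal) \<Rightarrow> ennreal" where
  "killed G i D t f = (\<integral>\<^sup>+\<omega>. f (\<omega> t) * (\<Prod>s\<le>t. indicator D (\<omega> s)) \<partial>walk_law G i)"

lemma killed_measurable:
  fixes f :: "'a \<Rightarrow> ennreal"
  assumes "t \<in> J" and "{..t} \<subseteq> J"
  shows "(\<lambda>\<omega>. f (\<omega> t) * (\<Prod>s\<le>t. indicator D (\<omega> s))) \<in> borel_measurable (PiM J (\<lambda>_. count_space UNIV))"
proof -
  have "(\<lambda>\<omega>. h (\<omega> s)) \<in> borel_measurable (PiM J (\<lambda>_. count_space UNIV))" if "s \<in> J" for s and h :: "'a \<Rightarrow> ennreal"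
    using that by (intro measurable_compose[OF measurable_component_singleton]) auto
  then show ?thesis
    using assms by (intro borel_measurable_times_ennreal borel_measurable_prod_ennreal) auto
qed

lemma emeasure_walk_law_space: "emeasure (walk_law G i) (space (walk_law G i)) = 1"
proof -
  interpret Ionescu_Tulcea "walk_kernel G i" "\<lambda>_. count_space UNIV"
    by (rule Ionescu_Tulcea_walk_kernel)
  interpret C: prob_space "C 0 0 (\<lambda>_. undefined)"
    by (rule prob_space_C) (simp add: space_PiM)
  show ?thesis
    using nn_integral_walk_law_restrict[of "\<lambda>_. 1" 0 G i] C.emeasure_space_1
    by (simp del: C.simps)
qed

lemma killed_0: "killed G i D 0 f = f i * indicator D i"
proof -
  let ?g = "\<lambda>\<omega>. f (\<omega> 0) * (\<Prod>s\<le>0. indicator D (\<omega> s))"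
  have "?g \<in> borel_measurable (PiM {0..<Suc 0} (\<lambda>_. count_space UNIV))"
    by (rule killed_measurable) auto
  from nn_integral_walk_law_extend[OF this, of G i] show ?thesis
    by (simp add: killed_def walk_kernel_def emeasure_walk_law_space)
qed

text \<open>The Markov property: the last position is averaged over a step from
  \<open>\<omega> t\<close>, and its survival factor moves into the integrand.\<close>

lemma killed_Suc:
  "killed G i D (Suc t) f = killed G i D t (\<lambda>x. \<integral>\<^sup>+y. f y * indicator D y \<partial>step_pmf G x)"
proof -
  let ?g = "\<lambda>\<omega>. f (\<omega> (Suc t)) * (\<Prod>s\<le>Suc t. indicator D (\<omega> s))"
  have "killed G i D (Suc t) f = (\<integral>\<^sup>+\<omega>. ?g (restrict \<omega> {0..<Suc (Suc t)}) \<partial>walk_law G i)"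
    unfolding killed_def by (intro nn_integral_cong) (auto intro!: arg_cong2[where f="(*)"] prod.cong)
  also have "\<dots> = (\<integral>\<^sup>+\<omega>. (\<integral>\<^sup>+x. ?g ((restrict \<omega> {0..<Suc t})(Suc t := x))
         \<partial>walk_kernel G i (Suc t) (restrict \<omega> {0..<Suc t})) \<partial>walk_law G i)"
    by (rule nn_integral_walk_law_extend) (rule killed_measurable; auto)
  also have "\<dots> = killed G i D t (\<lambda>x. \<integral>\<^sup>+y. f y * indicator D y \<partial>step_pmf G x)"
    unfolding killed_def
  proof (intro nn_integral_cong)
    fix \<omega>
    have "?g ((restrict \<omega> {0..<Suc t})(Suc t := x)) = f x * indicator D x * (\<Prod>s\<le>t. indicator D (\<omega> s))" for x
      by (auto simp: mult_ac intro!: arg_cong2[where f="(*)"] prod.cong)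
    then show "(\<integral>\<^sup>+x. ?g ((restrict \<omega> {0..<Suc t})(Suc t := x)) \<partial>walk_kernel G i (Suc t) (restrict \<omega> {0..<Suc t}))
       = (\<integral>\<^sup>+y. f y * indicator D y \<partial>step_pmf G (\<omega> t)) * (\<Prod>s\<le>t. indicator D (\<omega> s))"
      by (simp add: walk_kernel_def nn_integral_multc)
  qed
  finally show ?thesis .
qed

text \<open>With \<open>D = UNIV\<close> nothing is killed, so the indicator of the complement of
  \<open>V\<close> yields the probability of being outside \<open>V\<close> at time
  \<open>t\<close>. It starts at 0 and cannot grow, since no step leads out of
  \<open>V\<close>.\<close>

lemma AE_walk_law_closed:
  assumes "i \<in> V" and "\<And>x. x \<in> V \<Longrightarrow> set_pmf (step_pmf G x) \<subseteq> V"
  shows "AE \<omega> in walk_law G i. \<omega> t \<in> V"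
proof -
  have "killed G i UNIV t (indicator (-V)) = 0"
  proof (induction t)
    case 0
    then show ?case using assms by (simp add: killed_0)
  next
    case (Suc t)
    have "(\<integral>\<^sup>+y. indicator (-V) y * indicator UNIV y \<partial>step_pmf G x) \<le> indicator (-V) x" for x
    proof (cases "x \<in> V")
      case True
      then have "emeasure (step_pmf G x) (-V) = 0"
        using assms(2)[of x] by (auto simp: measure_pmf.emeasure_eq_measure measure_pmf_zero_iff)
      then show ?thesis by simp
    next
      case False
      then show ?thesis by (simp add: measure_pmf.emeasure_le_1)
    qed
    then have "killed G i UNIV (Suc t) (indicator (-V)) \<le> killed G i UNIV t (indicator (-V))"
      unfolding killed_Suc by (auto simp: killed_def intro!: nn_integral_mono mult_right_mono)
    with Suc show ?case by simp
  qed
  then have "AE \<omega> in walk_law G i. indicator (-V) (\<omega> t) = (0 :: ennreal)"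
    unfolding killed_def
    by (subst (asm) nn_integral_0_iff_AE)
       (auto simp: measurable_cong_sets[OF sets_walk_law refl]
             intro!: measurable_compose[OF measurable_component_singleton])
  then show ?thesis by eventually_elim (auto split: split_indicator_asm)
qed

section \<open>Hitting times as sums of survival probabilities\<close>

lemma first_hit_eq_suminf: "first_hit j \<omega> = (\<Sum>t. \<Prod>s\<le>t. indicator (-{j}) (\<omega> s))"
proof (cases "\<exists>t. \<omega> t = j")
  case True
  define T where "T = (LEAST t. \<omega> t = j)"
  have T: "\<omega> T = j" unfolding T_def using True by (rule LeastI_ex)
  have less: "\<omega> s \<noteq> j" if "s < T" for s using that not_less_Least unfolding T_def by blast
  have "first_hit j \<omega> = of_nat T"
    unfolding first_hit_def
    by (rule antisym) (auto intro!: INF_lower INF_greatest simp: T, use less not_le in blast)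
  \<comment> \<open>The survival factor is 1 exactly before the first visit \<open>T\<close>, so the
    series counts the times from 0 to \<open>T - 1\<close>.\<close>
  moreover have "(\<Prod>s\<le>t. indicator (-{j}) (\<omega> s)) = (if t < T then 1 else 0 :: ennreal)" for t
  proof (cases "t < T")
    case True
    then show ?thesis using less by (auto intro!: prod.neutral)
  next
    case False
    then show ?thesis using T by (auto intro!: bexI[of _ T])
  qed
  moreover have "(\<Sum>t. (if t < T then 1 else 0 :: ennreal)) = (\<Sum>t<T. 1)"
    by (subst suminf_finite[of "{..<T}"]) auto
  ultimately show ?thesis by simp
next
  case False
  then have "(\<Prod>s\<le>t. indicator (-{j}) (\<omega> s)) = (1 :: ennreal)" for t by (auto intro!: prod.neutral)
  moreover have "first_hit j \<omega> = top" using False by (simp add: first_hit_def)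
  moreover have "(\<Sum>t. 1 :: ennreal) = top"
    using nn_integral_count_space_nat[of "\<lambda>_. 1"] by simp
  ultimately show ?thesis by simp
qed

text \<open>The tail-sum formula for an expectation: the nonnegative series for
  \<open>first_hit\<close> is integrated termwise.\<close>

lemma hitting_time_eq_suminf: "hitting_time G i j = (\<Sum>t. killed G i (-{j}) t (\<lambda>_. 1))"
  unfolding hitting_time_def first_hit_eq_suminf killed_def mult_1
  by (rule nn_integral_suminf)
     (use killed_measurable[of _ UNIV "\<lambda>_. 1" "-{j}"] in \<open>simp add: measurable_cong_sets[OF sets_walk_law refl]\<close>)

text \<open>Finiteness of \<open>h\<close> supplies the recurrence: \<open>h i\<close> bounds all
  partial sums of the survival probabilities, so these tend to 0 and the remainder, at most a
  constant times them, vanishes.\<close>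

lemma hitting_time_eqI:
  fixes h :: "'a \<Rightarrow> real"
  assumes "finite V" "i \<in> V"
    and closed: "\<And>x. x \<in> V \<Longrightarrow> set_pmf (step_pmf G x) \<subseteq> V"
    and h0: "\<And>x. x \<in> V \<Longrightarrow> h x \<ge> 0" and hj: "h j = 0"
    and h: "\<And>x. x \<in> V \<Longrightarrow> x \<noteq> j \<Longrightarrow> h x = 1 + (\<Sum>y\<in>V. pmf (step_pmf G x) y * h y)"
  shows "hitting_time G i j = ennreal (h i)"
proof -
  let ?A = "killed G i (-{j})" and ?h = "\<lambda>x. ennreal (h x)"
  have m: "(\<lambda>\<omega>. f (\<omega> t) * (\<Prod>s\<le>t. indicator D (\<omega> s))) \<in> borel_measurable (walk_law G i)" for f :: "'a \<Rightarrow> ennreal" and t D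
    using killed_measurable[of t UNIV f D] by (simp add: measurable_cong_sets[OF sets_walk_law refl])
  have AE: "AE \<omega> in walk_law G i. \<omega> t \<in> V" for t
    using AE_walk_law_closed assms by metis
  \<comment> \<open>As \<open>h j = 0\<close>, killing at \<open>j\<close> does not change the
    average of \<open>h\<close>, so the first-step equation can be stated for the killed
    walk.\<close>
  have Ph: "?h x = 1 + (\<integral>\<^sup>+y. ?h y * indicator (-{j}) y \<partial>step_pmf G x)" if x: "x \<in> V" "x \<noteq> j" for x
  proof -
    have "(\<integral>\<^sup>+y. ?h y * indicator (-{j}) y \<partial>step_pmf G x) = (\<integral>\<^sup>+y. ?h y \<partial>step_pmf G x)"
      using hj by (auto intro!: nn_integral_cong split: split_indicator)
    also have "\<dots> = (\<Sum>y\<in>V. ennreal (pmf (step_pmf G x) y * h y))"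
      using assms(1) closed[OF x(1)] h0
      by (subst nn_integral_measure_pmf_support[of V]) (auto simp: ennreal_mult mult.commute intro!: sum.cong)
    also have "\<dots> = ennreal (\<Sum>y\<in>V. pmf (step_pmf G x) y * h y)"
      using h0 by (intro sum_ennreal) auto
    finally show ?thesis
      using h[OF x] h0 by (simp add: ennreal_plus sum_nonneg)
  qed
  \<comment> \<open>The equation for \<open>h\<close> fails to hold only at \<open>j\<close> and
    outside \<open>V\<close>; there the survival factor is 0, respectively the event is
    null.\<close>
  have step: "?A t ?h = ?A t (\<lambda>_. 1) + ?A (Suc t) ?h" for t
  proof -
    have "?A t ?h = ?A t (\<lambda>x. 1 + (\<integral>\<^sup>+y. ?h y * indicator (-{j}) y \<partial>step_pmf G x))"
      unfolding killed_def
    proof (rule nn_integral_cong_AE, use AE[of t] in eventually_elim)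
      case (elim \<omega>)
      show ?case
      proof (cases "\<omega> t = j")
        case True
        then have "(\<Prod>s\<le>t. indicator (-{j}) (\<omega> s)) = (0 :: ennreal)"
          by (intro prod_zero) (auto intro!: bexI[of _ t])
        then show ?thesis by (simp only: mult_zero_right)
      qed (use Ph[OF elim] in simp)
    qed
    also have "\<dots> = ?A t (\<lambda>_. 1) + ?A (Suc t) ?h"
      unfolding killed_Suc unfolding killed_def distrib_right
      by (subst nn_integral_add[OF m m]) simp
    finally show ?thesis .
  qed
  have sum: "ennreal (h i) = (\<Sum>t<N. ?A t (\<lambda>_. 1)) + ?A N ?h" for N
  proof (induction N)
    case 0
    then show ?case using hj by (simp add: killed_0 split: split_indicator)
  next
    case (Suc N)
    then show ?case using step[of N] by (simp add: ac_simps)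
  qed
  define M where "M = (\<Sum>x\<in>V. h x)"
  have le: "?A N ?h \<le> ennreal M * ?A N (\<lambda>_. 1)" for N
  proof -
    have "h x \<le> M" if "x \<in> V" for x
      unfolding M_def using that assms(1) h0 by (intro member_le_sum) auto
    then have "?A N ?h \<le> ?A N (\<lambda>_. ennreal M)"
      unfolding killed_def using AE[of N]
      by (intro nn_integral_mono_AE) (auto elim!: eventually_mono intro!: mult_right_mono ennreal_leI)
    also have "\<dots> = ennreal M * ?A N (\<lambda>_. 1)"
      unfolding killed_def using m[of "\<lambda>_. 1"] by (simp add: nn_integral_cmult)
    finally show ?thesis .
  qed
  have upper: "hitting_time G i j \<le> ennreal (h i)"
    unfolding hitting_time_eq_suminf
  proof (rule suminf_le_const)
    show "(\<Sum>t<N. ?A t (\<lambda>_. 1)) \<le> ennreal (h i)" for N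
      unfolding sum[of N] by simp
  qed simp
  have "(\<lambda>N. ?A N (\<lambda>_. 1)) \<longlonglongrightarrow> 0"
  proof -
    define a where "a t = enn2real (?A t (\<lambda>_. 1))" for t
    have fin: "(\<Sum>t. ?A t (\<lambda>_. 1)) \<noteq> top"
      using upper unfolding hitting_time_eq_suminf by (auto simp: top_unique)
    then have a: "?A t (\<lambda>_. 1) = ennreal (a t)" for t
      unfolding a_def using ennreal_suminf_lessD[of "\<lambda>t. ?A t (\<lambda>_. 1)" top t]
      by (simp add: less_top)
    have "summable a"
      using fin unfolding a by (intro summable_suminf_not_top) (auto simp: a_def)
    then show ?thesis
      unfolding a using tendsto_ennrealI[OF summable_LIMSEQ_zero] by fastforce
  qed
  then have "(\<lambda>N. ennreal M * ?A N (\<lambda>_. 1)) \<longlonglongrightarrow> ennreal M * 0"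
    by (intro ennreal_tendsto_cmult) auto
  moreover have "(\<lambda>N. (\<Sum>t<N. ?A t (\<lambda>_. 1))) \<longlonglongrightarrow> hitting_time G i j"
    unfolding hitting_time_eq_suminf by (rule summable_LIMSEQ) auto
  ultimately have "(\<lambda>N. (\<Sum>t<N. ?A t (\<lambda>_. 1)) + ennreal M * ?A N (\<lambda>_. 1)) \<longlonglongrightarrow> hitting_time G i j + 0"
    by (intro tendsto_add) auto
  then have "ennreal (h i) \<le> hitting_time G i j + 0"
  proof (rule LIMSEQ_le_const, intro exI allI impI)
    show "ennreal (h i) \<le> (\<Sum>t<N. ?A t (\<lambda>_. 1)) + ennreal M * ?A N (\<lambda>_. 1)" for N
      unfolding sum[of N] by (intro add_left_mono le)
  qed
  then have "ennreal (h i) \<le> hitting_time G i j" by simp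
  with upper show ?thesis by (rule antisym)
qed

section \<open>Sums over the vertices of \<open>W\<^sub>n\<close>\<close>

lemma New_notin_verts_W: "New (Suc n) i k b \<notin> verts (W \<delta> n)"
  using level_le[of "New (Suc n) i k b" \<delta> n] by auto

text \<open>\<open>New\<close> is injective and its level is fresh, so the new vertices are counted
  once each and are disjoint from the old ones.\<close>

lemma sum_verts_W_Suc:
  "(\<Sum>v\<in>verts (W \<delta> (Suc n)). f v) = (\<Sum>v\<in>verts (W \<delta> n). f v) +
    (\<Sum>i\<in>verts (W \<delta> n). \<Sum>k<strength (W \<delta> n) i div 2.
       f (New (Suc n) i k False) + f (New (Suc n) i k True))"
proof -
  let ?V = "verts (W \<delta> n)" and ?N = "\<lambda>((i, k), b). New (Suc n) i k b"
  let ?S = "SIGMA i:?V. {..<strength (W \<delta> n) i div 2}"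
  have V: "verts (W \<delta> (Suc n)) = ?V \<union> ?N ` (?S \<times> UNIV)"
    by (force simp: new_copies_def)
  have "(\<Sum>v\<in>verts (W \<delta> (Suc n)). f v) = (\<Sum>v\<in>?V. f v) + (\<Sum>v\<in>?N ` (?S \<times> UNIV). f v)"
    unfolding V using finite_W[of \<delta> n] New_notin_verts_W[of n]
    by (intro sum.union_disjoint finite_imageI finite_cartesian_product finite_SigmaI) auto
  also have "(\<Sum>v\<in>?N ` (?S \<times> UNIV). f v) = (\<Sum>p\<in>?S \<times> UNIV. f (?N p))"
    by (subst sum.reindex) (auto simp: inj_on_def)
  also have "\<dots> = (\<Sum>p\<in>?S. \<Sum>b\<in>UNIV. f (?N (p, b)))"
    by (subst sum.cartesian_product) (simp add: case_prod_beta)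
  also have "\<dots> = (\<Sum>i\<in>?V. \<Sum>k<strength (W \<delta> n) i div 2. \<Sum>b\<in>UNIV. f (New (Suc n) i k b))"
    using finite_W[of \<delta> n] by (subst sum.Sigma) (auto intro!: sum.cong)
  finally show ?thesis by (simp add: UNIV_bool add.commute)
qed

lemma weight_W_Suc_old:
  assumes "u \<in> verts (W \<delta> n)" "v \<in> verts (W \<delta> n)"
  shows "weight (W \<delta> (Suc n)) u v = (1 + \<delta>) * weight (W \<delta> n) u v"
  using assms New_notin_verts_W[of n] by (auto simp: new_edges_def doubleton_eq_iff)

lemma weight_W_Suc_old_new:
  assumes "u \<in> verts (W \<delta> n)" "(j, k) \<in> new_copies (W \<delta> n)"
  shows "weight (W \<delta> (Suc n)) u (New (Suc n) j k b) = of_bool (u = j)"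
  using assms New_notin_verts_W[of n] weight_outside[of u \<delta> n "New (Suc n) j k b"]
  by (auto simp: new_edges_def doubleton_eq_iff)

lemma weight_W_Suc_new:
  assumes "(i, k) \<in> new_copies (W \<delta> n)" "(j, l) \<in> new_copies (W \<delta> n)"
  shows "weight (W \<delta> (Suc n)) (New (Suc n) i k b) (New (Suc n) j l c) = of_bool (i = j \<and> k = l \<and> b \<noteq> c)"
  using assms New_notin_verts_W[of n] weight_outside[of "New (Suc n) i k b" \<delta> n "New (Suc n) j l c"]
  by (cases b; cases c) (auto simp: new_edges_def doubleton_eq_iff new_copies_def)

text \<open>Such a sum is the strength times the one-step average of \<open>f\<close>. This and its
  analogue at a new vertex carry first-step equations from one stage to the next;
  \<open>f = 1\<close> gives the strengths.\<close>

lemma sum_weight_W_Suc_old: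
  fixes f :: "vertex \<Rightarrow> real"
  assumes i: "i \<in> verts (W \<delta> n)"
  shows "(\<Sum>v\<in>verts (W \<delta> (Suc n)). weight (W \<delta> (Suc n)) i v * f v)
    = (1 + \<delta>) * (\<Sum>v\<in>verts (W \<delta> n). weight (W \<delta> n) i v * f v)
      + (\<Sum>k<strength (W \<delta> n) i div 2. f (New (Suc n) i k False) + f (New (Suc n) i k True))"
proof -
  let ?V = "verts (W \<delta> n)" and ?w = "weight (W \<delta> (Suc n)) i"
  have "(\<Sum>v\<in>?V. ?w v * f v) = (1 + \<delta>) * (\<Sum>v\<in>?V. weight (W \<delta> n) i v * f v)"
    unfolding sum_distrib_left using i by (intro sum.cong) (simp_all only: weight_W_Suc_old, simp add: algebra_simps)
  moreover have "(\<Sum>j\<in>?V. \<Sum>k<strength (W \<delta> n) j div 2.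
        ?w (New (Suc n) j k False) * f (New (Suc n) j k False) + ?w (New (Suc n) j k True) * f (New (Suc n) j k True))
     = (\<Sum>j\<in>?V. if j = i then \<Sum>k<strength (W \<delta> n) j div 2. f (New (Suc n) j k False) + f (New (Suc n) j k True) else 0)"
    using weight_W_Suc_old_new[OF i] by (intro sum.cong) (auto simp: new_copies_def simp del: W.simps intro!: sum.neutral)
  ultimately show ?thesis
    unfolding sum_verts_W_Suc[of _ \<delta> n] using i finite_W by (simp add: sum.delta')
qed

lemma sum_weight_W_Suc_new:
  fixes f :: "vertex \<Rightarrow> real"
  assumes ik: "(i, k) \<in> new_copies (W \<delta> n)"
  shows "(\<Sum>v\<in>verts (W \<delta> (Suc n)). weight (W \<delta> (Suc n)) (New (Suc n) i k b) v * f v)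
    = f i + f (New (Suc n) i k (\<not> b))"
proof -
  let ?V = "verts (W \<delta> n)" and ?w = "weight (W \<delta> (Suc n)) (New (Suc n) i k b)"
  have i: "i \<in> ?V" "k < strength (W \<delta> n) i div 2" using ik by (auto simp: new_copies_def)
  have "(\<Sum>v\<in>?V. ?w v * f v) = (\<Sum>v\<in>?V. if v = i then f v else 0)"
    using weight_W_Suc_old_new[OF _ ik]
    by (intro sum.cong) (auto simp: weight_commute[of \<delta> "Suc n" "New (Suc n) i k b"] simp del: W.simps)
  moreover have "(\<Sum>j\<in>?V. \<Sum>l<strength (W \<delta> n) j div 2.
        ?w (New (Suc n) j l False) * f (New (Suc n) j l False) + ?w (New (Suc n) j l True) * f (New (Suc n) j l True))
     = (\<Sum>j\<in>?V. if j = i then \<Sum>l<strength (W \<delta> n) j div 2. if l = k then f (New (Suc n) j l (\<not> b)) else 0 else 0)"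
    using weight_W_Suc_new[OF ik] by (intro sum.cong refl; cases b)
      (auto simp: new_copies_def simp del: W.simps intro!: sum.neutral sum.cong)
  ultimately show ?thesis
    unfolding sum_verts_W_Suc[of _ \<delta> n] using i finite_W by (simp add: sum.delta')
qed

section \<open>Strengths of the vertices and their total\<close>

lemma strength_W_Suc_old:
  assumes "i \<in> verts (W \<delta> n)"
  shows "strength (W \<delta> (Suc n)) i = (2 + \<delta>) * strength (W \<delta> n) i"
proof -
  have "real (strength (W \<delta> (Suc n)) i) = real ((1 + \<delta>) * strength (W \<delta> n) i + 2 * (strength (W \<delta> n) i div 2))"
    using sum_weight_W_Suc_old[OF assms, of "\<lambda>_. 1"] by (simp add: strength_def algebra_simps del: W.simps)
  then show ?thesis
    using even_strength_W[OF assms] unfolding of_nat_eq_iff by (simp add: algebra_simps)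
qed

lemma strength_W_Suc_new:
  assumes "(i, k) \<in> new_copies (W \<delta> n)"
  shows "strength (W \<delta> (Suc n)) (New (Suc n) i k b) = 2"
proof -
  have "real (strength (W \<delta> (Suc n)) (New (Suc n) i k b)) = real 2"
    using sum_weight_W_Suc_new[OF assms, of b "\<lambda>_. 1"] by (simp add: strength_def del: W.simps)
  then show ?thesis unfolding of_nat_eq_iff .
qed

lemma verts_W_Suc_cases:
  assumes "v \<in> verts (W \<delta> (Suc n))"
  obtains "v \<in> verts (W \<delta> n)" | i k b where "(i, k) \<in> new_copies (W \<delta> n)" "v = New (Suc n) i k b"
  using assms by auto

lemma verts_W_Suc_iff:
  "v \<in> verts (W \<delta> (Suc n)) \<longleftrightarrow>
    v \<in> verts (W \<delta> n) \<or> (\<exists>i k b. (i, k) \<in> new_copies (W \<delta> n) \<and> v = New (Suc n) i k b)"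
  by auto

lemma strength_W_pos: "i \<in> verts (W \<delta> n) \<Longrightarrow> strength (W \<delta> n) i > 0"
proof (induction n arbitrary: i)
  case 0
  then show ?case by (auto simp: strength_def)
next
  case (Suc n)
  from Suc.prems show ?case
    by (cases rule: verts_W_Suc_cases) (auto simp: strength_W_Suc_old strength_W_Suc_new Suc.IH simp del: W.simps)
qed

text \<open>Old vertices contribute the factor \<open>2 + \<delta>\<close>. Each copy adds strength
  4, so those attached to a vertex add twice its old strength; in all the total is multiplied by
  \<open>\<delta> + 4\<close>.\<close>

lemma sum_strength_W: "(\<Sum>v\<in>verts (W \<delta> n). strength (W \<delta> n) v) = 6 * (\<delta> + 4) ^ n"
proof (induction n)
  case 0
  show ?case by (simp add: strength_def)
next
  case (Suc n)
  let ?V = "verts (W \<delta> n)" and ?s = "strength (W \<delta> n)"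
  have "(\<Sum>i\<in>?V. \<Sum>k<?s i div 2. strength (W \<delta> (Suc n)) (New (Suc n) i k False)
      + strength (W \<delta> (Suc n)) (New (Suc n) i k True)) = (\<Sum>i\<in>?V. 2 * ?s i)"
  proof (intro sum.cong refl)
    fix i assume i: "i \<in> ?V"
    then have "(\<Sum>k<?s i div 2. strength (W \<delta> (Suc n)) (New (Suc n) i k False)
      + strength (W \<delta> (Suc n)) (New (Suc n) i k True)) = (\<Sum>k<?s i div 2. 4)"
      by (intro sum.cong refl) (simp add: strength_W_Suc_new new_copies_def del: W.simps)
    then show "(\<Sum>k<?s i div 2. strength (W \<delta> (Suc n)) (New (Suc n) i k False)
      + strength (W \<delta> (Suc n)) (New (Suc n) i k True)) = 2 * ?s i"
      using even_strength_W[OF i] by auto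
  qed
  then have "(\<Sum>v\<in>verts (W \<delta> (Suc n)). strength (W \<delta> (Suc n)) v) = (2 + \<delta>) * (\<Sum>v\<in>?V. ?s v) + 2 * (\<Sum>v\<in>?V. ?s v)"
    unfolding sum_verts_W_Suc[of _ \<delta> n] sum_distrib_left
    by (simp add: strength_W_Suc_old cong: sum.cong del: W.simps)
  also have "\<dots> = (\<delta> + 4) * (6 * (\<delta> + 4) ^ n)"
    unfolding Suc.IH by (simp add: algebra_simps)
  finally show ?case by simp
qed

section \<open>The hitting times of \<open>W\<^sub>n\<close>\<close>

text \<open>The first-step equations are multiplied by the strength, so that they involve the
  integer weights directly.\<close>

definition hitting_solution :: "'a weighted_graph \<Rightarrow> ('a \<Rightarrow> 'a \<Rightarrow> real) \<Rightarrow> bool" where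
  "hitting_solution G H \<longleftrightarrow>
     (\<forall>x\<in>verts G. \<forall>y\<in>verts G. H x y \<ge> 0) \<and>
     (\<forall>y\<in>verts G. H y y = 0) \<and>
     (\<forall>x\<in>verts G. \<forall>y\<in>verts G. x \<noteq> y \<longrightarrow>
        real (strength G x) * H x y =
          real (strength G x) + (\<Sum>v\<in>verts G. real (weight G x v) * H v y))"

text \<open>Equivalently, the mean return time to \<open>y\<close> is the reciprocal of its stationary probability.\<close>

lemma return_sum:
  fixes H :: "'a \<Rightarrow> 'a \<Rightarrow> real"
  assumes H: "hitting_solution G H" and fin: "finite (verts G)" and y: "y \<in> verts G"
    and sym: "\<And>u v. weight G u v = weight G v u"
  shows "(\<Sum>v\<in>verts G. weight G y v * H v y) = real (\<Sum>v\<in>verts G. strength G v) - strength G y"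
proof -
  let ?V = "verts G" and ?P = "\<lambda>x. \<Sum>v\<in>verts G. weight G x v * H v y"
  \<comment> \<open>By symmetry of the weights, summing over all starts gives the strength-weighted
    sum of \<open>H v y\<close>. The first-step equations evaluate that sum away from
    \<open>y\<close>; comparison isolates the term at \<open>y\<close>.\<close>
  have "(\<Sum>x\<in>?V. ?P x) = (\<Sum>v\<in>?V. \<Sum>x\<in>?V. weight G v x * H v y)"
    by (subst sum.swap) (simp add: sym)
  also have "\<dots> = (\<Sum>v\<in>?V. strength G v * H v y)"
    by (simp add: strength_def sum_distrib_right)
  also have "\<dots> = (\<Sum>v\<in>?V - {y}. strength G v * H v y)"
    using H y fin by (simp add: sum.remove[OF fin y] hitting_solution_def)
  also have "\<dots> = (\<Sum>v\<in>?V - {y}. strength G v + ?P v)"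
    using H y by (intro sum.cong) (auto simp: hitting_solution_def)
  also have "\<dots> = (\<Sum>v\<in>?V - {y}. real (strength G v)) + (\<Sum>v\<in>?V - {y}. ?P v)"
    by (simp add: sum.distrib)
  finally show ?thesis
    using y fin by (simp add: sum.remove[OF fin y, of ?P] sum.remove[OF fin y, of "strength G"])
qed

section \<open>From the hitting times of one stage to those of the next\<close>

primrec parent :: "vertex \<Rightarrow> vertex" where
  "parent (Base m) = Base m"
| "parent (New n i k b) = i"

primrec twin :: "vertex \<Rightarrow> vertex" where
  "twin (Base m) = Base m"
| "twin (New n i k b) = New n i k (\<not> b)"

text \<open>A copy is entered and left only through its attaching vertex, so the times of the phases
  add: 2 to leave, the slowed walk between the roots, \<open>a\<close> to enter. From the twin of
  the target, the first step hits with probability 1/2 and otherwise leads to the attaching vertex,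
  hence \<open>1 + a / 2\<close>.\<close>

definition extend_hit :: "nat \<Rightarrow> real \<Rightarrow> real \<Rightarrow> (vertex \<Rightarrow> vertex \<Rightarrow> real) \<Rightarrow> vertex \<Rightarrow> vertex \<Rightarrow> real" where
  "extend_hit m T a H x y =
    (let root = (\<lambda>v. if level v = m then parent v else v) in
     if x = y then 0
     else if level y = m \<and> x = twin y then 1 + a / 2
     else (if level x = m then 2 else 0) + T * H (root x) (root y) + (if level y = m then a else 0))"

lemma extend_hit_old:
  assumes "level x \<noteq> m" "level y \<noteq> m" "H y y = 0"
  shows "extend_hit m T a H x y = T * H x y"
  using assms by (auto simp: extend_hit_def)

lemma extend_hit_new_old:
  assumes "level y \<noteq> m"
  shows "extend_hit m T a H (New m i k b) y = 2 + T * H i y"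
  using assms by (auto simp: extend_hit_def)

lemma extend_hit_old_new:
  assumes "level x \<noteq> m"
  shows "extend_hit m T a H x (New m j l c) = T * H x j + a"
  using assms by (auto simp: extend_hit_def)

lemma extend_hit_new:
  "extend_hit m T a H (New m i k b) (New m j l c) =
    (if i = j \<and> k = l then if b = c then 0 else 1 + a / 2 else 2 + T * H i j + a)"
  by (auto simp: extend_hit_def)

text \<open>The equations are checked for old and new \<open>x\<close> and \<open>y\<close>
  separately. Two old vertices account for the value of \<open>T\<close>, and a target attached to
  the old start \<open>x\<close> accounts for that of \<open>a\<close>.\<close>

lemma extend_hit_solution:
  fixes \<delta> n :: nat and H :: "vertex \<Rightarrow> vertex \<Rightarrow> real"
  assumes H: "hitting_solution (W \<delta> n) H"
  defines "T \<equiv> (4 + real \<delta>) / (1 + real \<delta>)" and "a \<equiv> 4 * (real \<delta> + 4) ^ Suc n - 2"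
  shows "hitting_solution (W \<delta> (Suc n)) (extend_hit (Suc n) T a H)"
proof -
  let ?V = "verts (W \<delta> n)" and ?V' = "verts (W \<delta> (Suc n))" and ?N = "New (Suc n)"
  let ?s = "strength (W \<delta> n)" and ?H = "extend_hit (Suc n) T a H"
  let ?P = "\<lambda>x y. \<Sum>v\<in>?V. weight (W \<delta> n) x v * H v y"
  have T: "T \<ge> 0" "T * (1 + \<delta>) = 4 + \<delta>"
    unfolding T_def by auto
  have a: "a \<ge> 0"
  proof -
    have "(1::real) \<le> (real \<delta> + 4) ^ Suc n" by (intro one_le_power) auto
    then show ?thesis unfolding a_def by linarith
  qed
  have nonneg: "H x y \<ge> 0" and diag: "H y y = 0" if "x \<in> ?V" "y \<in> ?V" for x y
    using H that by (auto simp: hitting_solution_def)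
  have hit: "?P x y = ?s x * H x y - ?s x" if "x \<in> ?V" "y \<in> ?V" "x \<noteq> y" for x y
    using H that by (auto simp: hitting_solution_def)
  \<comment> \<open>The first-step equations leave out the diagonal; its value enters when the start
    is the attaching vertex of the target.\<close>
  have ret: "?P y y = 6 * (real \<delta> + 4) ^ n - ?s y" if "y \<in> ?V" for y
    using return_sum[OF H finite_W that weight_commute] by (simp add: sum_strength_W)
  have lev [simp]: "level x \<noteq> Suc n" if "x \<in> ?V" for x
    using level_le[OF that] by simp
  have copies: "i \<in> ?V" if "(i, k) \<in> new_copies (W \<delta> n)" for i k
    using that by (simp add: new_copies_def)
  have half: "real (?s x) = 2 * real (?s x div 2)" if "x \<in> ?V" for x
    using even_strength_W[OF that] by (metis dvd_mult_div_cancel of_nat_mult of_nat_numeral)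
  note vals = extend_hit_old extend_hit_new_old extend_hit_old_new extend_hit_new
  have "?H x y \<ge> 0" if "x \<in> ?V'" "y \<in> ?V'" for x y
    using that nonneg T(1) a unfolding verts_W_Suc_iff
    by (auto simp: vals diag copies)
  moreover have "?H y y = 0" for y by (simp add: extend_hit_def)
  moreover have "strength (W \<delta> (Suc n)) x * ?H x y
      = strength (W \<delta> (Suc n)) x + (\<Sum>v\<in>?V'. weight (W \<delta> (Suc n)) x v * ?H v y)"
    if x: "x \<in> ?V'" and y: "y \<in> ?V'" and ne: "x \<noteq> y" for x y
    using x
  proof (cases rule: verts_W_Suc_cases)
    case x: 1
    have s: "real (strength (W \<delta> (Suc n)) x) = (2 + \<delta>) * ?s x"
      using strength_W_Suc_old[OF x] by simp
    show ?thesis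
      using y
    proof (cases rule: verts_W_Suc_cases)
      case y: 1
      have "(\<Sum>v\<in>?V. weight (W \<delta> n) x v * ?H v y) = T * ?P x y"
        using y by (simp add: vals diag sum_distrib_left mult_ac cong: sum.cong)
      also have "?P x y = ?s x * H x y - ?s x" by (rule hit[OF x y ne])
      finally have "(\<Sum>v\<in>?V'. weight (W \<delta> (Suc n)) x v * ?H v y)
         = (1 + \<delta>) * (T * (?s x * H x y - ?s x)) + (2 * real (?s x div 2)) * (2 + T * H x y)"
        using y by (simp add: sum_weight_W_Suc_old[OF x] vals del: W.simps)
      also have "\<dots> = (T * (1 + \<delta>)) * (?s x * H x y - ?s x) + ?s x * (2 + T * H x y)"
        unfolding half[OF x, symmetric] by (simp add: algebra_simps)
      finally show ?thesis
        unfolding s using x y T(2) by (simp add: vals diag) algebra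
    next
      case y: (2 j l c)
      have j: "j \<in> ?V" "l < ?s j div 2" using y by (auto simp: new_copies_def)
      have "(\<Sum>v\<in>?V. weight (W \<delta> n) x v * ?H v y) = T * ?P x j + ?s x * a"
        using y by (simp add: vals sum_distrib_left sum_distrib_right sum.distrib strength_def algebra_simps cong: sum.cong)
      then have P: "(\<Sum>v\<in>?V'. weight (W \<delta> (Suc n)) x v * ?H v y) = (T * (1 + \<delta>)) * ?P x j + (1 + \<delta>) * ?s x * a
          + (\<Sum>k<?s x div 2. ?H (?N x k False) y + ?H (?N x k True) y)"
        by (simp add: sum_weight_W_Suc_old[OF x] algebra_simps del: W.simps)
      show ?thesis
      proof (cases "x = j")
        case False
        have N: "(\<Sum>k<?s x div 2. ?H (?N x k False) y + ?H (?N x k True) y) = ?s x * (2 + T * H x j + a)"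
          using False y half[OF x] by (simp add: vals)
        have "?H x y = T * H x j + a"
          using x y by (simp add: vals)
        then show ?thesis
          unfolding s P N hit[OF x j(1) False] T(2) using T(2) by simp algebra
      next
        case True
        \<comment> \<open>The copy containing \<open>y\<close> contributes 0 and
          \<open>1 + a / 2\<close> instead of \<open>2 + a\<close> twice, which is the correction at
          \<open>k = l\<close>.\<close>
        have "(\<Sum>k<?s x div 2. ?H (?N x k False) y + ?H (?N x k True) y)
          = (\<Sum>k<?s x div 2. 2 * (2 + a) + (if k = l then 1 + a / 2 - 2 * (2 + a) else 0))"
          using True y diag[OF x x] by (intro sum.cong) (auto simp: vals)
        also have "\<dots> = ?s x * (2 + a) + (1 + a / 2 - 2 * (2 + a))"
          using True j half[OF x] by (simp add: sum.distrib sum.delta')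
        finally have N: "(\<Sum>k<?s x div 2. ?H (?N x k False) y + ?H (?N x k True) y)
          = ?s x * (2 + a) + (1 + a / 2 - 2 * (2 + a))" .
        \<comment> \<open>All terms proportional to the strength of \<open>x\<close> cancel, and
          this relation between \<open>a\<close> and the total strength of the new graph
          remains.\<close>
        have a_eq: "6 * (real \<delta> + 4) ^ n * (\<delta> + 4) = 3 * a / 2 + 3"
          unfolding a_def by (simp add: field_simps)
        have Hxy: "?H x y = a"
          using x y True diag[OF x x] by (simp add: vals)
        have Px: "?P x j = 6 * (real \<delta> + 4) ^ n - ?s x"
          using True ret[OF x] by simp
        show ?thesis
          unfolding s P N T(2) Hxy Px using a_eq by (simp add: algebra_simps)
      qed
    qed
  next
    case x: (2 i k b)
    have i: "i \<in> ?V" using x copies by simp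
    \<comment> \<open>A new vertex has two neighbours of weight 1, its attaching vertex and its
      twin.\<close>
    have P: "(\<Sum>v\<in>?V'. weight (W \<delta> (Suc n)) x v * ?H v y) = ?H i y + ?H (?N i k (\<not> b)) y"
      unfolding x(2) by (rule sum_weight_W_Suc_new[OF x(1)])
    have s: "strength (W \<delta> (Suc n)) x = 2"
      unfolding x(2) by (rule strength_W_Suc_new[OF x(1)])
    show ?thesis
      using y
    proof (cases rule: verts_W_Suc_cases)
      case 1
      then show ?thesis unfolding P s using x i by (simp add: vals diag)
    next
      case (2 j l c)
      then show ?thesis unfolding P s using x i ne diag[OF i i] by (auto simp: vals)
    qed
  qed
  ultimately show ?thesis
    unfolding hitting_solution_def by blast
qed

text \<open>Independence of the start is inherited: a new start costs 2 more than its attaching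
  vertex for targets outside its copy, and the total excess over all targets,
  \<open>12 * (\<delta> + 4) ^ Suc n\<close>, is offset by the saving \<open>6 + 3 * a\<close> in
  its own copy.\<close>

lemma extend_hit_kemeny:
  fixes \<delta> n :: nat and H :: "vertex \<Rightarrow> vertex \<Rightarrow> real"
  assumes H: "hitting_solution (W \<delta> n) H"
    and K: "\<And>i. i \<in> verts (W \<delta> n) \<Longrightarrow> (\<Sum>j\<in>verts (W \<delta> n). strength (W \<delta> n) j * H i j) = c"
    and x: "x \<in> verts (W \<delta> (Suc n))"
  defines "T \<equiv> (4 + real \<delta>) / (1 + real \<delta>)" and "a \<equiv> 4 * (real \<delta> + 4) ^ Suc n - 2"
  shows "(\<Sum>j\<in>verts (W \<delta> (Suc n)). strength (W \<delta> (Suc n)) j * extend_hit (Suc n) T a H x j)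
    = (4 + real \<delta>) * T * c + 12 * (real \<delta> + 4) ^ n * a"
proof -
  let ?V = "verts (W \<delta> n)" and ?V' = "verts (W \<delta> (Suc n))" and ?N = "New (Suc n)"
  let ?s = "strength (W \<delta> n)" and ?H = "extend_hit (Suc n) T a H" and ?S = "6 * (real \<delta> + 4) ^ n"
  have diag: "H y y = 0" if "y \<in> ?V" for y
    using H that by (auto simp: hitting_solution_def)
  have lev [simp]: "level x \<noteq> Suc n" if "x \<in> ?V" for x
    using level_le[OF that] by simp
  have half: "real (?s x) = 2 * real (?s x div 2)" if "x \<in> ?V" for x
    using even_strength_W[OF that] by (metis dvd_mult_div_cancel of_nat_mult of_nat_numeral)
  have S: "(\<Sum>j\<in>?V. real (?s j)) = ?S"
    using arg_cong[OF sum_strength_W[of \<delta> n], of real] by simp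
  note vals = extend_hit_old extend_hit_new_old extend_hit_old_new extend_hit_new
  have "(\<Sum>i\<in>?V. \<Sum>k<?s i div 2.
      strength (W \<delta> (Suc n)) (?N i k False) * ?H x (?N i k False) + strength (W \<delta> (Suc n)) (?N i k True) * ?H x (?N i k True))
    = (\<Sum>i\<in>?V. \<Sum>k<?s i div 2. 2 * ?H x (?N i k False) + 2 * ?H x (?N i k True))"
    by (intro sum.cong) (auto simp: strength_W_Suc_new new_copies_def simp del: W.simps)
  then have split: "(\<Sum>j\<in>?V'. strength (W \<delta> (Suc n)) j * ?H x j) = (2 + \<delta>) * (\<Sum>j\<in>?V. ?s j * ?H x j)
    + (\<Sum>i\<in>?V. \<Sum>k<?s i div 2. 2 * ?H x (?N i k False) + 2 * ?H x (?N i k True))"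
    unfolding sum_verts_W_Suc[of _ \<delta> n] sum_distrib_left
    by (simp add: strength_W_Suc_old algebra_simps cong: sum.cong del: W.simps)
  have sumH: "(\<Sum>j\<in>?V. ?s j * (p + T * H i j)) = p * ?S + T * c" if "i \<in> ?V" for p i
    unfolding K[OF that, symmetric] S[symmetric]
    by (simp add: sum.distrib sum_distrib_left algebra_simps)
  from x show ?thesis
  proof (cases rule: verts_W_Suc_cases)
    case x: 1
    have "(\<Sum>j\<in>?V. ?s j * ?H x j) = (\<Sum>j\<in>?V. ?s j * (0 + T * H x j))"
      using x by (intro sum.cong) (auto simp: vals diag)
    moreover have "(\<Sum>i\<in>?V. \<Sum>k<?s i div 2. 2 * ?H x (?N i k False) + 2 * ?H x (?N i k True))
      = 2 * (\<Sum>j\<in>?V. ?s j * (a + T * H x j))"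
      unfolding sum_distrib_left using x
      by (intro sum.cong) (auto simp: vals half algebra_simps)
    ultimately show ?thesis
      unfolding split sumH[OF x] by (simp add: algebra_simps)
  next
    case x: (2 i k b)
    have i: "i \<in> ?V" "k < ?s i div 2" using x by (auto simp: new_copies_def)
    have "(\<Sum>j\<in>?V. ?s j * ?H x j) = (\<Sum>j\<in>?V. ?s j * (2 + T * H i j))"
      using x by (intro sum.cong) (auto simp: vals)
    \<comment> \<open>The copy of \<open>x\<close> contributes \<open>2 + a\<close> instead of
      \<open>4 * (2 + a)\<close>, which differs by \<open>- 6 - 3 * a\<close>.\<close>
    moreover have "(\<Sum>j\<in>?V. \<Sum>l<?s j div 2. 2 * ?H x (?N j l False) + 2 * ?H x (?N j l True))
      = 2 * (\<Sum>j\<in>?V. ?s j * ((2 + a) + T * H i j)) - 6 - 3 * a"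
    proof -
      have "(\<Sum>l<?s j div 2. 2 * ?H x (?N j l False) + 2 * ?H x (?N j l True))
        = 2 * (?s j * ((2 + a) + T * H i j)) + (if j = i then - 6 - 3 * a else 0)" if j: "j \<in> ?V" for j
      proof -
        have "(\<Sum>l<?s j div 2. 2 * ?H x (?N j l False) + 2 * ?H x (?N j l True))
          = (\<Sum>l<?s j div 2. 4 * (2 + a + T * H i j) + (if l = k then if j = i then - 6 - 3 * a else 0 else 0))"
          using x diag[OF i(1)] by (intro sum.cong) (cases b; auto simp: vals)+
        also have "\<dots> = 2 * (?s j * ((2 + a) + T * H i j)) + (if j = i then - 6 - 3 * a else 0)"
          using half[OF j] i by (auto simp: sum.distrib sum.delta')
        finally show ?thesis .
      qed
      then show ?thesis
        using i finite_W[of \<delta> n] by (simp add: sum.distrib sum.delta' sum_distrib_left)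
    qed
    ultimately show ?thesis
      unfolding split sumH[OF i(1)] by (simp add: a_def algebra_simps)
  qed
qed

section \<open>The closed form and the conclusion\<close>

definition kemeny_formula :: "real \<Rightarrow> nat \<Rightarrow> real" where
  "kemeny_formula d n = (4 * d * (d + 1) ^ (n + 1) + 24 * (d + 4) ^ n * (d + 1) ^ (n + 1)
     - 12 * (d + 2) * (d + 4) ^ n) / (3 * d * (d + 4) * (d + 1) ^ n)"

lemma kemeny_formula_0: "d > 0 \<Longrightarrow> kemeny_formula d 0 = 4 / 3"
  unfolding kemeny_formula_def by (simp add: divide_simps) (simp add: algebra_simps)

text \<open>Multiplied by the total strength, the closed form satisfies the recurrence of
  \<open>extend_hit_kemeny\<close>.\<close>

lemma kemeny_formula_Suc:
  assumes "d > 0"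
  shows "6 * (d + 4) ^ Suc n * kemeny_formula d (Suc n) =
    (4 + d) * ((4 + d) / (1 + d)) * (6 * (d + 4) ^ n * kemeny_formula d n)
      + 12 * (d + 4) ^ n * (4 * (d + 4) ^ Suc n - 2)"
proof -
  \<comment> \<open>With the powers named, the claim is an identity of rational functions in
    \<open>d\<close>, \<open>P\<close> and \<open>Q\<close>.\<close>
  define P Q where "P = (d + 4) ^ n" and "Q = (d + 1) ^ n"
  have pos: "d > 0" "P > 0" "Q > 0" using assms by (auto simp: P_def Q_def)
  have "(4 + d) * ((4 + d) / (1 + d)) * (6 * P * ((4 * d * (Q * (d + 1)) + 24 * P * (Q * (d + 1))
        - 12 * (d + 2) * P) / (3 * d * (d + 4) * Q))) + 12 * P * (4 * (P * (d + 4)) - 2)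
    = 6 * (P * (d + 4)) * ((4 * d * (Q * (d + 1) * (d + 1)) + 24 * (P * (d + 4)) * (Q * (d + 1) * (d + 1))
        - 12 * (d + 2) * (P * (d + 4))) / (3 * d * (d + 4) * (Q * (d + 1))))"
    using pos by (simp add: divide_simps) algebra
  then show ?thesis
    by (simp add: kemeny_formula_def P_def Q_def mult_ac)
qed

lemma exists_hitting_solution_W:
  fixes \<delta> n :: nat
  assumes "\<delta> \<ge> 1"
  obtains H :: "vertex \<Rightarrow> vertex \<Rightarrow> real" where "hitting_solution (W \<delta> n) H"
    "\<And>i. i \<in> verts (W \<delta> n) \<Longrightarrow> (\<Sum>j\<in>verts (W \<delta> n). strength (W \<delta> n) j * H i j) =
      6 * (real \<delta> + 4) ^ n * kemeny_formula \<delta> n"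
proof (induction n arbitrary: thesis)
  case 0
  \<comment> \<open>On the triangle, \<open>h = 1 + h / 2\<close> gives hitting time 2 between
    distinct vertices.\<close>
  show ?case
    using assms
    by (intro 0[of "\<lambda>x y. if x = y then 0 else 2"])
       (auto simp: hitting_solution_def strength_def kemeny_formula_0)
next
  case (Suc n)
  obtain H :: "vertex \<Rightarrow> vertex \<Rightarrow> real" where H: "hitting_solution (W \<delta> n) H"
    "\<And>i. i \<in> verts (W \<delta> n) \<Longrightarrow> (\<Sum>j\<in>verts (W \<delta> n). strength (W \<delta> n) j * H i j) =
      6 * (real \<delta> + 4) ^ n * kemeny_formula \<delta> n"
    using Suc.IH by blast
  have "real \<delta> > 0" using assms by simp
  from kemeny_formula_Suc[OF this, of n] show ?case
    by (intro Suc.prems[OF extend_hit_solution[OF H(1)]]) (simp only: extend_hit_kemeny[OF H])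
qed

text \<open>Vanishing weights keep the walk inside the vertex set, and division by the positive
  strength gives the equations of \<open>hitting_time_eqI\<close>.\<close>

lemma hitting_solution_W:
  assumes H: "hitting_solution (W \<delta> n) H" and i: "i \<in> verts (W \<delta> n)" and j: "j \<in> verts (W \<delta> n)"
  shows "hitting_time (W \<delta> n) i j = ennreal (H i j)"
proof (rule hitting_time_eqI[OF finite_W i])
  let ?G = "W \<delta> n"
  show "set_pmf (step_pmf ?G x) \<subseteq> verts ?G" if "x \<in> verts ?G" for x
    using weight_outside[of x \<delta> n] that
    by (fastforce simp: set_pmf_iff pmf_step_pmf_W[OF strength_W_pos[OF that]])
  show "H x j = 1 + (\<Sum>y\<in>verts ?G. pmf (step_pmf ?G x) y * H y j)" if x: "x \<in> verts ?G" "x \<noteq> j" for x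
  proof -
    have s: "strength ?G x > 0" by (rule strength_W_pos[OF x(1)])
    have P: "(\<Sum>y\<in>verts ?G. pmf (step_pmf ?G x) y * H y j)
        = (\<Sum>y\<in>verts ?G. weight ?G x y * H y j) / strength ?G x"
      by (simp add: pmf_step_pmf_W[OF s] sum_divide_distrib)
    have "strength ?G x * H x j = strength ?G x + (\<Sum>y\<in>verts ?G. weight ?G x y * H y j)"
      using H x j by (auto simp: hitting_solution_def)
    then show ?thesis unfolding P using s by (simp add: field_simps)
  qed
qed (use H j in \<open>auto simp: hitting_solution_def\<close>)

theorem theorem5p1:
  fixes \<delta> n :: nat and i :: vertex
  assumes "\<delta> \<ge> 1" and "i \<in> verts (W \<delta> n)"
  shows "mean_hitting_time (W \<delta> n) i =
    ennreal ((4 * real \<delta> * (real \<delta> + 1) ^ (n + 1)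
              + 24 * (real \<delta> + 4) ^ n * (real \<delta> + 1) ^ (n + 1)
              - 12 * (real \<delta> + 2) * (real \<delta> + 4) ^ n)
             / (3 * real \<delta> * (real \<delta> + 4) * (real \<delta> + 1) ^ n))"
proof -
  let ?V = "verts (W \<delta> n)" and ?s = "strength (W \<delta> n)"
  obtain H :: "vertex \<Rightarrow> vertex \<Rightarrow> real" where H: "hitting_solution (W \<delta> n) H"
    and K: "\<And>i. i \<in> ?V \<Longrightarrow> (\<Sum>j\<in>?V. ?s j * H i j) = 6 * (real \<delta> + 4) ^ n * kemeny_formula \<delta> n"
    using exists_hitting_solution_W[OF assms(1)] by blast
  have "hitting_time (W \<delta> n) i j = ennreal (H i j)" if j: "j \<in> ?V" for j
    using hitting_solution_W[OF H assms(2) j] .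
  moreover have pos: "stationary (W \<delta> n) j \<ge> 0" for j
    unfolding stationary_def by (intro divide_nonneg_nonneg of_nat_0_le_iff)
  ultimately have "mean_hitting_time (W \<delta> n) i = (\<Sum>j\<in>?V. ennreal (stationary (W \<delta> n) j * H i j))"
    using H assms(2) unfolding mean_hitting_time_def
    by (intro sum.cong) (auto simp: hitting_solution_def ennreal_mult)
  also have "\<dots> = ennreal (\<Sum>j\<in>?V. stationary (W \<delta> n) j * H i j)"
    using H assms(2) by (intro sum_ennreal) (auto simp: hitting_solution_def pos)
  \<comment> \<open>The common denominator of the stationary probabilities is the total strength, a
    factor of the sum in \<open>K\<close>.\<close>
  also have "(\<Sum>j\<in>?V. stationary (W \<delta> n) j * H i j) = (\<Sum>j\<in>?V. ?s j * H i j) / (6 * (real \<delta> + 4) ^ n)"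
    unfolding stationary_def sum_strength_W by (simp add: sum_divide_distrib)
  also have "\<dots> = kemeny_formula \<delta> n"
    unfolding K[OF assms(2)] by (rule nonzero_mult_div_cancel_left) simp
  finally show ?thesis
    unfolding kemeny_formula_def .
qed

end
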